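(* The assertion "every $4$-total coloring of a cubic graph of order less than $20$ is equitable" is false, and the circular ladder $L_{12}$ is a counterexample of smallest possible order: $L_{12}$ admits a non-equitable $4$-total coloring, and for every cubic graph $G$ of order less than $12$, every $4$-total coloring of $G$ is equitable.
   Context: All graphs are finite, simple and cubic ($3$-regular), not necessarily connected. The order of a graph is its number of vertices. A $4$-total coloring of $G$ assigns one of the four colors $1,2,3,4$ to each vertex and each edge of $G$ so that adjacent vertices receive distinct colors, adjacent edges (edges sharing an endpoint) receive distinct colors, and every vertex and edge that are incident receive distinct colors. The color class $c_i$ is the set of all vertices and edges of color $i$. The coloring is equitable if $\bigl||c_i|-|c_j|\bigr| \le 1$ for all $i,j \in \{1,2,3,4\}$, and non-equitable otherwise. For even $n\ge 6$, the circular ladder $L_n$ is the prism $C_{n/2} \,\square\, K_2$ (Cartesian product of a cycle on $n/2$ vertices with $K_2$), which has $n$ vertices; thus $L_{12} = C_6 \,\square\, K_2$. *)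

theory Defs
  imports Main
begin

record 'a graph =
  verts :: "'a set"
  edges :: "'a set set"

definition simple_graph :: "'a graph \<Rightarrow> bool" where
  "simple_graph G \<longleftrightarrow>
     finite (verts G) \<and> (\<forall>e \<in> edges G. e \<subseteq> verts G \<and> card e = 2)"

definition order :: "'a graph \<Rightarrow> nat" where
  "order G = card (verts G)"

definition degree :: "'a graph \<Rightarrow> 'a \<Rightarrow> nat" where
  "degree G v = card {e \<in> edges G. v \<in> e}"

definition cubic_graph :: "'a graph \<Rightarrow> bool" where
  "cubic_graph G \<longleftrightarrow> simple_graph G \<and> (\<forall>v \<in> verts G. degree G v = 3)"

text \<open>A total coloring is a function on the disjoint sum of vertices (\<open>Inl\<close>) and edges
  (\<open>Inr\<close>); its values outside \<open>elements G\<close> are irrelevant.\<close>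

definition elements :: "'a graph \<Rightarrow> ('a + 'a set) set" where
  "elements G = verts G <+> edges G"

definition total_coloring :: "nat \<Rightarrow> 'a graph \<Rightarrow> ('a + 'a set \<Rightarrow> nat) \<Rightarrow> bool" where
  "total_coloring k G c \<longleftrightarrow>
     (\<forall>x \<in> elements G. c x \<in> {1..k}) \<and>
     (\<forall>u \<in> verts G. \<forall>v \<in> verts G. {u, v} \<in> edges G \<longrightarrow> c (Inl u) \<noteq> c (Inl v)) \<and>
     (\<forall>e \<in> edges G. \<forall>f \<in> edges G. e \<noteq> f \<and> e \<inter> f \<noteq> {} \<longrightarrow> c (Inr e) \<noteq> c (Inr f)) \<and>
     (\<forall>v \<in> verts G. \<forall>e \<in> edges G. v \<in> e \<longrightarrow> c (Inl v) \<noteq> c (Inr e))"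

definition color_class :: "'a graph \<Rightarrow> ('a + 'a set \<Rightarrow> nat) \<Rightarrow> nat \<Rightarrow> ('a + 'a set) set" where
  "color_class G c i = {x \<in> elements G. c x = i}"

definition equitable :: "nat \<Rightarrow> 'a graph \<Rightarrow> ('a + 'a set \<Rightarrow> nat) \<Rightarrow> bool" where
  "equitable k G c \<longleftrightarrow>
     (\<forall>i \<in> {1..k}. \<forall>j \<in> {1..k}.
        \<bar>int (card (color_class G c i)) - int (card (color_class G c j))\<bar> \<le> 1)"

text \<open>A simple graph with the intended cycle only for \<open>m \<ge> 3\<close>.\<close>

definition cycle_graph :: "nat \<Rightarrow> nat graph" where
  "cycle_graph m = \<lparr>verts = {..<m}, edges = {{i, (i + 1) mod m} | i. i < m}\<rparr>"

definition complete_graph :: "nat \<Rightarrow> nat graph" where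
  "complete_graph m = \<lparr>verts = {..<m}, edges = {{i, j} | i j. i < m \<and> j < m \<and> i \<noteq> j}\<rparr>"

definition cartesian_product :: "'a graph \<Rightarrow> 'b graph \<Rightarrow> ('a \<times> 'b) graph" where
  "cartesian_product G H =
     \<lparr>verts = verts G \<times> verts H,
      edges = {{(u, v), (u', v')} | u v u' v'.
        u \<in> verts G \<and> u' \<in> verts G \<and> v \<in> verts H \<and> v' \<in> verts H \<and>
        (u = u' \<and> {v, v'} \<in> edges H \<or> v = v' \<and> {u, u'} \<in> edges G)}\<rparr>"

text \<open>The prism with \<open>n\<close> vertices (not \<open>n\<close> rungs); meaningful for even \<open>n \<ge> 6\<close>.\<close>

definition circular_ladder :: "nat \<Rightarrow> (nat \<times> nat) graph" where
  "circular_ladder n = cartesian_product (cycle_graph (n div 2)) (complete_graph 2)"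

end

theory Submission
  imports Defs "HOL-Library.Nat_Bijection"
begin

text \<open>In a 4-total coloring of a cubic graph every vertex sees all four colors, on itself and
  its three edges. If color \<open>i\<close> is used on \<open>v\<^sub>i\<close> vertices and \<open>e\<^sub>i\<close> edges of a graph of order
  \<open>n\<close>, then \<open>v\<^sub>i + 2 e\<^sub>i = n\<close>, so the coloring is equitable iff the \<open>v\<^sub>i\<close> differ by at most 2.
  For \<open>i \<noteq> j\<close> the edges of color \<open>j\<close> match the vertices of color \<open>i\<close> into the vertices colored
  neither \<open>i\<close> nor \<open>j\<close>, so \<open>2 v\<^sub>i + v\<^sub>j \<le> n\<close>. Since \<open>n\<close> is the sum of the \<open>v\<^sub>i\<close>, this forces
  equitability for \<open>n < 12\<close>. At \<open>n = 12\<close> the distribution \<open>(4, 4, 4, 0)\<close> is left, and it is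
  realised on the prism by giving all rungs color 4 and coloring both cycles periodically
  with the other three colors.\<close>

section \<open>Splitting a color class into its vertices and its edges\<close>

definition colored_verts :: "'a graph \<Rightarrow> ('a + 'a set \<Rightarrow> nat) \<Rightarrow> nat \<Rightarrow> 'a set" where
  "colored_verts G c i = {v \<in> verts G. c (Inl v) = i}"

definition colored_edges :: "'a graph \<Rightarrow> ('a + 'a set \<Rightarrow> nat) \<Rightarrow> nat \<Rightarrow> 'a set set" where
  "colored_edges G c i = {e \<in> edges G. c (Inr e) = i}"

lemma finite_verts: "simple_graph G \<Longrightarrow> finite (verts G)"
  by (simp add: simple_graph_def)

lemma finite_edges: "simple_graph G \<Longrightarrow> finite (edges G)"
  by (rule finite_subset[of _ "Pow (verts G)"]) (auto simp: simple_graph_def)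

lemma edge_at_vertex:
  assumes "simple_graph G" "e \<in> edges G" "v \<in> e"
  obtains w where "w \<in> verts G" "w \<noteq> v" "e = {v, w}"
proof -
  have "card e = 2" "e \<subseteq> verts G"
    using assms by (auto simp: simple_graph_def)
  then obtain a b where "e = {a, b}" "a \<noteq> b" "a \<in> verts G" "b \<in> verts G"
    by (auto simp: card_2_iff)
  then show thesis
    using that \<open>v \<in> e\<close> by (metis insert_commute insert_iff singletonD)
qed

lemma card_color_class_eq_sum:
  assumes "simple_graph G"
  shows "card (color_class G c i) = card (colored_verts G c i) + card (colored_edges G c i)"
proof -
  have "color_class G c i = colored_verts G c i <+> colored_edges G c i"
    by (auto simp: color_class_def elements_def colored_verts_def colored_edges_def)
  then show ?thesis
    using finite_verts[OF assms] finite_edges[OF assms]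
    by (simp add: card_Plus colored_verts_def colored_edges_def)
qed

section \<open>Counting relations in a cubic graph with a 4-total coloring\<close>

locale cubic_coloring =
  fixes G :: "'a graph" and c :: "'a + 'a set \<Rightarrow> nat"
  assumes cubic: "cubic_graph G" and coloring: "total_coloring 4 G c"
begin

lemma simple: "simple_graph G"
  using cubic by (simp add: cubic_graph_def)

lemma vertex_color: "v \<in> verts G \<Longrightarrow> c (Inl v) \<in> {1..4}"
  using coloring by (auto simp: total_coloring_def elements_def)

lemma edge_color: "e \<in> edges G \<Longrightarrow> c (Inr e) \<in> {1..4}"
  using coloring by (auto simp: total_coloring_def elements_def)

lemma adjacent_colors:
  "u \<in> verts G \<Longrightarrow> v \<in> verts G \<Longrightarrow> {u, v} \<in> edges G \<Longrightarrow> c (Inl u) \<noteq> c (Inl v)"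
  using coloring by (auto simp: total_coloring_def)

lemma incident_colors:
  "v \<in> verts G \<Longrightarrow> e \<in> edges G \<Longrightarrow> v \<in> e \<Longrightarrow> c (Inl v) \<noteq> c (Inr e)"
  using coloring by (auto simp: total_coloring_def)

lemma same_color_edges_eq:
  "e \<in> edges G \<Longrightarrow> f \<in> edges G \<Longrightarrow> v \<in> e \<Longrightarrow> v \<in> f \<Longrightarrow> c (Inr e) = c (Inr f) \<Longrightarrow> e = f"
  using coloring unfolding total_coloring_def by blast

text \<open>The three edges at \<open>v\<close> have distinct colors, all different from the color
  of \<open>v\<close>, so they exhaust the three remaining colors.\<close>

lemma edge_of_color:
  assumes "v \<in> verts G" "i \<in> {1..4}" "i \<noteq> c (Inl v)"
  obtains e where "e \<in> edges G" "v \<in> e" "c (Inr e) = i"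
proof -
  let ?E = "{e \<in> edges G. v \<in> e}"
  let ?C = "(\<lambda>e. c (Inr e)) ` ?E"
  have "inj_on (\<lambda>e. c (Inr e)) ?E"
    by (auto intro!: inj_onI dest: same_color_edges_eq)
  then have "card ?C = 3"
    using cubic assms(1) by (simp add: card_image cubic_graph_def degree_def)
  moreover have "card ({1..4} - {c (Inl v)}) = 3"
    using vertex_color[OF assms(1)] by simp
  moreover have "?C \<subseteq> {1..4} - {c (Inl v)}"
    using edge_color incident_colors[OF assms(1)] by fastforce
  ultimately have "?C = {1..4} - {c (Inl v)}"
    by (intro card_subset_eq) auto
  then have "i \<in> ?C"
    using assms by simp
  then show thesis
    using that by auto
qed

text \<open>The edges of color \<open>i\<close> are pairwise disjoint, and the vertices they miss
  are exactly those of color \<open>i\<close>: a vertex of another color has an edge of color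
  \<open>i\<close>, a vertex of color \<open>i\<close> has none.\<close>

lemma order_eq_color_count:
  assumes "i \<in> {1..4}"
  shows "order G = card (colored_verts G c i) + 2 * card (colored_edges G c i)"
proof -
  let ?V = "colored_verts G c i" and ?E = "colored_edges G c i"
  have fin: "finite ?V" "finite ?E"
    using finite_verts[OF simple] finite_edges[OF simple]
    by (auto simp: colored_verts_def colored_edges_def)
  have edge: "e \<subseteq> verts G" "card e = 2" "finite e" if "e \<in> ?E" for e
  proof -
    show "e \<subseteq> verts G" "card e = 2"
      using that simple by (auto simp: colored_edges_def simple_graph_def)
    then show "finite e"
      by (metis card.infinite zero_neq_numeral)
  qed
  have "verts G = ?V \<union> \<Union>?E"
  proof
    show "verts G \<subseteq> ?V \<union> \<Union>?E"
    proof
      fix v assume v: "v \<in> verts G"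
      show "v \<in> ?V \<union> \<Union>?E"
      proof (cases "c (Inl v) = i")
        case False
        then obtain e where "e \<in> edges G" "v \<in> e" "c (Inr e) = i"
          using edge_of_color[OF v assms] by metis
        then show ?thesis by (auto simp: colored_edges_def)
      qed (use v in \<open>auto simp: colored_verts_def\<close>)
    qed
  qed (use edge in \<open>auto simp: colored_verts_def\<close>)
  moreover have "?V \<inter> \<Union>?E = {}"
    using incident_colors by (fastforce simp: colored_verts_def colored_edges_def)
  ultimately have "card (verts G) = card ?V + card (\<Union>?E)"
    using fin edge by (simp add: card_Un_disjoint)
  also have "card (\<Union>?E) = (\<Sum>e\<in>?E. card e)"
  proof (rule card_Union_disjoint)
    show "pairwise disjnt ?E"
      unfolding pairwise_def disjnt_def colored_edges_def using same_color_edges_eq by blast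
  qed (use edge in auto)
  also have "\<dots> = 2 * card ?E"
    using edge by simp
  finally show ?thesis
    by (simp add: order_def)
qed

text \<open>This eliminates the edge counts: class sizes can be compared through vertex counts
  alone, and \<open>order G\<close> plus any vertex count is even.\<close>

lemma card_color_class:
  assumes "i \<in> {1..4}"
  shows "2 * card (color_class G c i) = order G + card (colored_verts G c i)"
  using card_color_class_eq_sum[OF simple] order_eq_color_count[OF assms] by simp

lemma order_eq_sum_colored_verts: "order G = (\<Sum>i\<in>{1..4}. card (colored_verts G c i))"
proof -
  have "verts G = (\<Union>i\<in>{1..4}. colored_verts G c i)"
    using vertex_color by (auto simp: colored_verts_def)
  then have "order G = card (\<Union>i\<in>{1..4}. colored_verts G c i)"
    by (simp add: order_def)
  also have "\<dots> = (\<Sum>i\<in>{1..4}. card (colored_verts G c i))"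
    using finite_verts[OF simple] by (intro card_UN_disjoint) (auto simp: colored_verts_def)
  finally show ?thesis .
qed

lemma two_color_bound:
  assumes "i \<noteq> j" "j \<in> {1..4}"
  shows "2 * card (colored_verts G c i) + card (colored_verts G c j) \<le> order G"
proof -
  let ?Vi = "colored_verts G c i" and ?Vj = "colored_verts G c j"
  have fin: "finite (verts G)"
    by (rule finite_verts[OF simple])
  have "\<exists>w. w \<in> verts G \<and> {v, w} \<in> edges G \<and> c (Inr {v, w}) = j" if "v \<in> ?Vi" for v
  proof -
    have "v \<in> verts G" "j \<noteq> c (Inl v)"
      using that assms by (auto simp: colored_verts_def)
    then obtain e where "e \<in> edges G" "v \<in> e" "c (Inr e) = j"
      using edge_of_color assms(2) by metis
    then show ?thesis
      using edge_at_vertex[OF simple] by metis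
  qed
  \<comment> \<open>\<open>p\<close> moves each vertex of color \<open>i\<close> across its edge of
    color \<open>j\<close>. It is injective because two edges of color \<open>j\<close> that meet at
    a common image coincide.\<close>
  then obtain p where p: "\<And>v. v \<in> ?Vi \<Longrightarrow> p v \<in> verts G"
    "\<And>v. v \<in> ?Vi \<Longrightarrow> {v, p v} \<in> edges G" "\<And>v. v \<in> ?Vi \<Longrightarrow> c (Inr {v, p v}) = j"
    by metis
  have "inj_on p ?Vi"
  proof (rule inj_onI)
    fix u v assume "u \<in> ?Vi" "v \<in> ?Vi" "p u = p v"
    then have "{u, p u} = {v, p u}"
      using same_color_edges_eq[of "{u, p u}" "{v, p v}" "p u"] p
      by (metis insert_iff)
    then show "u = v"
      by (auto simp: doubleton_eq_iff)
  qed
  moreover have "p ` ?Vi \<subseteq> verts G - (?Vi \<union> ?Vj)"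
  proof
    fix w assume "w \<in> p ` ?Vi"
    then obtain v where v: "v \<in> ?Vi" "w = p v" by auto
    have "c (Inl v) = i" "v \<in> verts G"
      using v by (auto simp: colored_verts_def)
    moreover have "c (Inl v) \<noteq> c (Inl w)" "c (Inl w) \<noteq> j"
      using adjacent_colors[of v w] incident_colors[of w "{v, w}"] v p \<open>v \<in> verts G\<close> by auto
    ultimately show "w \<in> verts G - (?Vi \<union> ?Vj)"
      using v p by (auto simp: colored_verts_def)
  qed
  ultimately have "card ?Vi \<le> card (verts G - (?Vi \<union> ?Vj))"
    using fin by (metis card_image card_mono finite_Diff)
  also have "\<dots> = order G - card (?Vi \<union> ?Vj)"
    unfolding order_def
    by (rule card_Diff_subset) (auto simp: colored_verts_def fin intro: finite_subset[OF _ fin])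
  also have "card (?Vi \<union> ?Vj) = card ?Vi + card ?Vj"
    using fin assms by (intro card_Un_disjoint) (auto simp: colored_verts_def)
  finally have "card ?Vi \<le> order G - (card ?Vi + card ?Vj)" .
  \<comment> \<open>Subtraction on \<open>nat\<close> is truncated, so the previous inequality
    yields the claim only once the subtrahend is known not to exceed \<open>order G\<close>.\<close>
  moreover have "card ?Vi + card ?Vj \<le> order G"
    unfolding order_def \<open>card (?Vi \<union> ?Vj) = card ?Vi + card ?Vj\<close>[symmetric]
    by (rule card_mono[OF fin]) (auto simp: colored_verts_def)
  ultimately show ?thesis by simp
qed

end

text \<open>All counts are even, so a violation means that \<open>v i\<close> exceeds
  \<open>v j\<close> by at least 4. The bounds then force both remaining counts to be at least 4,
  whence \<open>n \<ge> 12\<close>. The distribution (4, 4, 4, 0) shows that 12 is sharp.\<close>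

lemma color_distribution_balanced:
  fixes v :: "nat \<Rightarrow> nat"
  assumes "n < 12" "n = (\<Sum>i\<in>{1..4}. v i)"
    and parity: "\<And>i. i \<in> {1..4} \<Longrightarrow> even (n + v i)"
    and bound: "\<And>i j. i \<in> {1..4} \<Longrightarrow> j \<in> {1..4} \<Longrightarrow> i \<noteq> j \<Longrightarrow> 2 * v i + v j \<le> n"
    and ij: "i \<in> {1..4}" "j \<in> {1..4}"
  shows "v i \<le> v j + 2"
proof (cases "i = j")
  case False
  have "card ({1..4} - {i, j}) = 2"
    using False ij by (simp add: card_Diff_subset)
  then obtain k l where kl: "{1..4} - {i, j} = {k, l}" "k \<noteq> l"
    by (auto simp: card_2_iff)
  have kl_mem: "k \<in> {1..4}" "l \<in> {1..4}" "k \<noteq> i" "l \<noteq> i"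
    using kl by blast+
  have "sum v {1..4} = sum v ({1..4} - {i, j}) + sum v {i, j}"
    using ij by (intro sum.subset_diff) auto
  then have sum: "n = v i + v j + v k + v l"
    using assms(2) False kl by simp
  \<comment> \<open>This sum is \<open>4 * n + n\<close>, so its parity is that of
    \<open>n\<close>.\<close>
  have "even (\<Sum>i\<in>{1..4}. n + v i)"
    using parity by (intro dvd_sum) auto
  then have "even n"
    using assms(2) by (simp add: sum.distrib)
  then have "even (v i)" "even (v j)" "even (v k)" "even (v l)"
    using parity ij kl_mem by (metis even_add)+
  then obtain m a b c d where "n = 2 * m" "v i = 2 * a" "v j = 2 * b" "v k = 2 * c" "v l = 2 * d"
    using \<open>even n\<close> by (metis dvdE)
  moreover have "2 * v i + v j \<le> n" "2 * v i + v k \<le> n" "2 * v i + v l \<le> n"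
    using bound ij kl_mem False by auto
  ultimately have "m < 6" "m = a + b + c + d" "2 * a + b \<le> m" "2 * a + c \<le> m" "2 * a + d \<le> m"
    and thesis_iff: "v i \<le> v j + 2 \<longleftrightarrow> \<not> b + 2 \<le> a"
    using sum \<open>n < 12\<close> by linarith+
  \<comment> \<open>From \<open>2 * a + c \<le> m\<close> follows \<open>a \<le> b + d\<close>, and
    from \<open>2 * a + d \<le> m\<close> follows \<open>a \<le> b + c\<close>. If
    \<open>b + 2 \<le> a\<close>, then \<open>a\<close>, \<open>c\<close> and \<open>d\<close> are
    all at least 2, against \<open>m < 6\<close>.\<close>
  then have "\<not> b + 2 \<le> a"
    by linarith
  with thesis_iff show ?thesis
    by simp
qed simp

section \<open>Equitability in terms of vertex counts, and orders below 12\<close>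

context cubic_coloring
begin

text \<open>By \<open>card_color_class\<close>, two color classes differ in size by half the
  difference of their vertex counts.\<close>

lemma equitable_iff:
  "equitable 4 G c \<longleftrightarrow>
    (\<forall>i\<in>{1..4}. \<forall>j\<in>{1..4}. card (colored_verts G c i) \<le> card (colored_verts G c j) + 2)"
proof -
  have *: "\<bar>int (card (color_class G c i)) - int (card (color_class G c j))\<bar> \<le> 1 \<longleftrightarrow>
      card (colored_verts G c i) \<le> card (colored_verts G c j) + 2 \<and>
      card (colored_verts G c j) \<le> card (colored_verts G c i) + 2"
    if "i \<in> {1..4}" "j \<in> {1..4}" for i j
    using card_color_class[OF that(1)] card_color_class[OF that(2)] by linarith
  show ?thesis
    unfolding equitable_def using * by blast
qed

lemma equitable_if_small:
  assumes "order G < 12"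
  shows "equitable 4 G c"
  unfolding equitable_iff
proof (intro ballI)
  fix i j :: nat
  assume "i \<in> {1..4}" "j \<in> {1..4}"
  then show "card (colored_verts G c i) \<le> card (colored_verts G c j) + 2"
  proof (rule color_distribution_balanced[OF assms order_eq_sum_colored_verts, rotated -2])
    show "even (order G + card (colored_verts G c k))" if "k \<in> {1..4}" for k
      using card_color_class[OF that] by (metis dvd_triv_left)
  qed (use two_color_bound in auto)
qed

end

section \<open>Relabeling vertices along an injection\<close>

definition map_graph :: "('a \<Rightarrow> 'b) \<Rightarrow> 'a graph \<Rightarrow> 'b graph" where
  "map_graph f G = \<lparr>verts = f ` verts G, edges = (`) f ` edges G\<rparr>"

text \<open>Colors are pulled back along \<open>inv f\<close>, applied to vertices and pointwise to
  edges. Its arbitrary values off the range of \<open>f\<close> are harmless, since every element of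
  the relabeled graph comes from the original one.\<close>

definition map_coloring :: "('a \<Rightarrow> 'b) \<Rightarrow> ('a + 'a set \<Rightarrow> nat) \<Rightarrow> 'b + 'b set \<Rightarrow> nat" where
  "map_coloring f c = c \<circ> map_sum (inv f) ((`) (inv f))"

lemma order_map_graph: "inj f \<Longrightarrow> order (map_graph f G) = order G"
  by (simp add: order_def map_graph_def card_image inj_on_subset)

lemma cubic_map_graph:
  assumes "inj f" "cubic_graph G"
  shows "cubic_graph (map_graph f G)"
proof -
  have "simple_graph (map_graph f G)"
    using assms
    by (auto simp: cubic_graph_def simple_graph_def map_graph_def card_image inj_on_subset)
  moreover have "degree (map_graph f G) (f v) = degree G v" for v
  proof -
    have "{e \<in> (`) f ` edges G. f v \<in> e} = (`) f ` {e \<in> edges G. v \<in> e}"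
      using inj_image_mem_iff[OF assms(1)] by blast
    moreover have "inj ((`) f)"
      using assms(1) by (simp add: inj_image_eq_iff inj_def)
    ultimately show ?thesis
      by (simp add: degree_def map_graph_def card_image inj_on_subset)
  qed
  ultimately show ?thesis
    using assms(2) by (auto simp: cubic_graph_def map_graph_def)
qed

text \<open>An injective \<open>f\<close> preserves and reflects adjacency, incidence, and equality
  and disjointness of edges, which is all that the coloring conditions refer to.\<close>

lemma total_coloring_map_graph:
  assumes "inj f" "total_coloring k G c"
  shows "total_coloring k (map_graph f G) (map_coloring f c)"
proof -
  have inv: "inv f ` f ` e = e" for e
    using assms(1) by (simp add: image_image)
  have "inj ((`) f)"
    using assms(1) by (simp add: inj_image_eq_iff inj_def)
  then have edge: "{f u, f v} \<in> (`) f ` E \<longleftrightarrow> {u, v} \<in> E" for u v E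
    using inj_image_mem_iff[of "(`) f" "{u, v}" E] by simp
  have disjoint: "f ` e \<inter> f ` e' = {} \<longleftrightarrow> e \<inter> e' = {}" for e e'
    using assms(1) by (simp flip: image_Int)
  show ?thesis
    using assms(2) unfolding total_coloring_def elements_def
    by (simp add: map_graph_def map_coloring_def ball_Un Plus_def image_image inv edge disjoint
        inj_image_mem_iff[OF assms(1)] inj_image_eq_iff[OF assms(1)] inv_f_f[OF assms(1)])
qed

lemma colored_verts_map_graph:
  "inj f \<Longrightarrow> colored_verts (map_graph f G) (map_coloring f c) i = f ` colored_verts G c i"
  by (auto simp: colored_verts_def map_graph_def map_coloring_def)

text \<open>Both sides reduce to vertex counts by \<open>equitable_iff\<close>, so only the vertices
  of each color have to be followed through \<open>f\<close>.\<close>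

lemma equitable_map_graph_iff:
  assumes "inj f" "cubic_graph G" "total_coloring 4 G c"
  shows "equitable 4 (map_graph f G) (map_coloring f c) \<longleftrightarrow> equitable 4 G c"
proof -
  interpret G: cubic_coloring G c
    using assms by unfold_locales
  interpret fG: cubic_coloring "map_graph f G" "map_coloring f c"
    using assms by unfold_locales (simp_all add: cubic_map_graph total_coloring_map_graph)
  show ?thesis
    using assms(1)
    by (simp add: G.equitable_iff fG.equitable_iff colored_verts_map_graph card_image inj_on_subset)
qed

section \<open>Explicit vertices and edges of the ladder\<close>

lemma verts_ladder: "verts (circular_ladder 12) = {..<6} \<times> {..<2}"
  by (simp add: circular_ladder_def cartesian_product_def cycle_graph_def complete_graph_def)

lemma edges_cartesian_product:
  "e \<in> edges (cartesian_product G H) \<longleftrightarrow>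
    (\<exists>u\<in>verts G. \<exists>v\<in>verts H. \<exists>v'\<in>verts H. {v, v'} \<in> edges H \<and> e = {(u, v), (u, v')}) \<or>
    (\<exists>u\<in>verts G. \<exists>u'\<in>verts G. \<exists>v\<in>verts H. {u, u'} \<in> edges G \<and> e = {(u, v), (u', v)})"
  unfolding cartesian_product_def by simp blast

text \<open>Indexing rungs by \<open>i\<close> and cycle edges by their starting point turns the
  edge set into images of finite sets, which can be enumerated and checked by
  simplification.\<close>

lemma edges_ladder:
  "edges (circular_ladder 12) =
    (\<lambda>i. {(i, 0), (i, 1)}) ` {..<6} \<union> (\<lambda>(i, b). {(i, b), ((i + 1) mod 6, b)}) ` ({..<6} \<times> {..<2})"
  (is "?L = ?R")
proof -
  have ladder: "circular_ladder 12 = cartesian_product (cycle_graph 6) (complete_graph 2)"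
    by (simp add: circular_ladder_def)
  have verts: "verts (cycle_graph 6) = {..<6}" "verts (complete_graph 2) = {..<2}"
    by (simp_all add: cycle_graph_def complete_graph_def)
  have rung: "{v, v'} \<in> edges (complete_graph 2) \<longleftrightarrow> v = 0 \<and> v' = 1 \<or> v = 1 \<and> v' = 0" for v v'
    by (auto simp: complete_graph_def less_2_cases_iff doubleton_eq_iff)
  have cycle: "{u, u'} \<in> edges (cycle_graph 6) \<longleftrightarrow>
      u < 6 \<and> u' = (u + 1) mod 6 \<or> u' < 6 \<and> u = (u' + 1) mod 6" for u u'
    by (auto simp: cycle_graph_def doubleton_eq_iff)
  show ?thesis
  proof (intro set_eqI iffI)
    fix e assume "e \<in> ?L"
    \<comment> \<open>The product lists its edges by ordered pairs of endpoints, so a cycle edge may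
      be traversed forwards or backwards; the last two cases separate these.\<close>
    then consider
        u v v' where "u < 6" "v = 0 \<and> v' = 1 \<or> v = 1 \<and> v' = 0" "e = {(u, v), (u, v')}"
      | u u' v where "u < 6" "u' = (u + 1) mod 6" "v < 2" "e = {(u, v), (u', v)}"
      | u u' v where "u' < 6" "u = (u' + 1) mod 6" "v < 2" "e = {(u, v), (u', v)}"
      unfolding ladder edges_cartesian_product verts rung cycle lessThan_iff Bex_def by blast
    then show "e \<in> ?R"
    proof cases
      case 1
      then have "e = {(u, 0), (u, 1)}"
        by (auto simp: insert_commute)
      with 1 show ?thesis by blast
    next
      case 2
      then have "(u, v) \<in> {..<6} \<times> {..<2}" "e = (\<lambda>(i, b). {(i, b), ((i + 1) mod 6, b)}) (u, v)"
        by auto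
      then show ?thesis by blast
    next
      case 3
      then have "(u', v) \<in> {..<6} \<times> {..<2}" "e = (\<lambda>(i, b). {(i, b), ((i + 1) mod 6, b)}) (u', v)"
        by (auto simp: insert_commute)
      then show ?thesis by blast
    qed
  next
    fix e assume "e \<in> ?R"
    then consider i where "i < 6" "e = {(i, 0), (i, 1)}"
      | i b where "i < 6" "b < 2" "e = {(i, b), ((i + 1) mod 6, b)}"
      by auto
    then show "e \<in> ?L"
    proof cases
      case 1
      then show ?thesis
        unfolding ladder edges_cartesian_product verts rung by fastforce
    next
      case 2
      moreover have "(i + 1) mod 6 < 6" by simp
      ultimately show ?thesis
        unfolding ladder edges_cartesian_product verts cycle lessThan_iff Bex_def by blast
    qed
  qed
qed

lemma lessThan_two_six: "{..<2::nat} = {0, 1}" "{..<6::nat} = {0, 1, 2, 3, 4, 5}"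
  by auto

lemmas edges_ladder_explicit = edges_ladder[unfolded lessThan_two_six, simplified]

section \<open>A non-equitable coloring of the ladder\<close>

definition star :: "'a set set \<Rightarrow> 'a \<Rightarrow> 'a set set" where
  "star E v = {e \<in> E. v \<in> e}"

text \<open>These rules evaluate the edges at a vertex by running through an explicitly listed edge
  set one edge at a time.\<close>

lemma star_simps:
  "star {} v = {}"
  "v \<in> e \<Longrightarrow> star (insert e E) v = insert e (star E v)"
  "v \<notin> e \<Longrightarrow> star (insert e E) v = star E v"
  by (auto simp: star_def)

text \<open>A rung is an edge whose endpoints have equal first coordinates. A cycle edge gets the color
  from \<open>{1, 2, 3}\<close> missing at its endpoints: three distinct residues modulo 3 add up to 0, so the
  third one is minus, that is twice, the sum of the other two.\<close>

definition ladder_coloring :: "(nat \<times> nat) + (nat \<times> nat) set \<Rightarrow> nat" where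
  "ladder_coloring x = (case x of
     Inl (i, b) \<Rightarrow> (i + b) mod 3 + 1
   | Inr e \<Rightarrow> if card (fst ` e) = 1 then 4 else 2 * (\<Sum>(i, b)\<in>e. i + b) mod 3 + 1)"

text \<open>Collects the conditions that concern a single edge and its endpoints; they are evaluated
  on the explicit list of edges. The pattern of period 3 closes up because 3 divides 6.\<close>

lemma ladder_coloring_edge:
  assumes "e \<in> edges (circular_ladder 12)"
  shows "ladder_coloring (Inr e) \<in> {1..4}"
    and "v \<in> e \<Longrightarrow> ladder_coloring (Inl v) \<noteq> ladder_coloring (Inr e)"
    and "u \<in> e \<Longrightarrow> v \<in> e \<Longrightarrow> u \<noteq> v \<Longrightarrow> ladder_coloring (Inl u) \<noteq> ladder_coloring (Inl v)"
proof -
  have "\<forall>e\<in>edges (circular_ladder 12). ladder_coloring (Inr e) \<in> {1..4} \<and>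
      (\<forall>v\<in>e. ladder_coloring (Inl v) \<noteq> ladder_coloring (Inr e) \<and>
        (\<forall>u\<in>e. u \<noteq> v \<longrightarrow> ladder_coloring (Inl u) \<noteq> ladder_coloring (Inl v)))"
    unfolding edges_ladder_explicit by (simp add: ladder_coloring_def)
  then show "ladder_coloring (Inr e) \<in> {1..4}"
    and "v \<in> e \<Longrightarrow> ladder_coloring (Inl v) \<noteq> ladder_coloring (Inr e)"
    and "u \<in> e \<Longrightarrow> v \<in> e \<Longrightarrow> u \<noteq> v \<Longrightarrow> ladder_coloring (Inl u) \<noteq> ladder_coloring (Inl v)"
    using assms by blast+
qed

text \<open>Cubicity and the distinctness of colors on edges sharing a vertex both concern the star
  of one vertex, so each is evaluated at the twelve vertices in turn.\<close>

lemma ladder_at_vertex: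
  assumes "v \<in> verts (circular_ladder 12)"
  shows "card (star (edges (circular_ladder 12)) v) = 3"
    and "inj_on (\<lambda>e. ladder_coloring (Inr e)) (star (edges (circular_ladder 12)) v)"
proof -
  have v: "v \<in> {0, 1, 2, 3, 4, 5} \<times> {0, 1}"
    using assms unfolding verts_ladder lessThan_two_six .
  then show "card (star (edges (circular_ladder 12)) v) = 3"
    unfolding edges_ladder_explicit
    by (elim SigmaE insertE emptyE; simp add: star_simps doubleton_eq_iff)
  show "inj_on (\<lambda>e. ladder_coloring (Inr e)) (star (edges (circular_ladder 12)) v)"
    using v unfolding edges_ladder_explicit
    by (elim SigmaE insertE emptyE; simp add: star_simps ladder_coloring_def doubleton_eq_iff)
qed

lemma cubic_ladder: "cubic_graph (circular_ladder 12)"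
proof -
  have "simple_graph (circular_ladder 12)"
    unfolding simple_graph_def verts_ladder edges_ladder_explicit by simp
  then show ?thesis
    using ladder_at_vertex(1) by (simp add: cubic_graph_def degree_def star_def)
qed

lemma total_coloring_ladder: "total_coloring 4 (circular_ladder 12) ladder_coloring"
  unfolding total_coloring_def
proof (intro conjI ballI impI)
  fix x assume "x \<in> elements (circular_ladder 12)"
  moreover have "ladder_coloring (Inl (i, b)) \<in> {1..4}" for i b
    using mod_less_divisor[of 3 "i + b"] by (simp add: ladder_coloring_def del: mod_less_divisor)
  ultimately show "ladder_coloring x \<in> {1..4}"
    using ladder_coloring_edge(1) by (auto simp: elements_def)
next
  fix u v assume "{u, v} \<in> edges (circular_ladder 12)"
  moreover from this have "card {u, v} = 2"
    using cubic_ladder by (simp add: cubic_graph_def simple_graph_def)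
  then have "u \<noteq> v"
    by auto
  ultimately show "ladder_coloring (Inl u) \<noteq> ladder_coloring (Inl v)"
    using ladder_coloring_edge(3) by blast
next
  fix e f
  assume ef: "e \<in> edges (circular_ladder 12)" "f \<in> edges (circular_ladder 12)"
    "e \<noteq> f \<and> e \<inter> f \<noteq> {}"
  then obtain v where v: "v \<in> e" "v \<in> f"
    by blast
  moreover have "v \<in> verts (circular_ladder 12)"
    using cubic_ladder ef(1) v(1) by (auto simp: cubic_graph_def simple_graph_def)
  ultimately show "ladder_coloring (Inr e) \<noteq> ladder_coloring (Inr f)"
    using ladder_at_vertex(2)[of v] ef unfolding inj_on_def star_def by blast
next
  fix v e assume "e \<in> edges (circular_ladder 12)" "v \<in> e"
  then show "ladder_coloring (Inl v) \<noteq> ladder_coloring (Inr e)"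
    by (rule ladder_coloring_edge(2))
qed

lemma not_equitable_ladder: "\<not> equitable 4 (circular_ladder 12) ladder_coloring"
proof -
  interpret cubic_coloring "circular_ladder 12" ladder_coloring
    by unfold_locales (rule cubic_ladder total_coloring_ladder)+
  \<comment> \<open>The four vertices whose coordinate sum is divisible by 3. Color 4 occurs on no
    vertex, since vertex colors are residues modulo 3 plus 1; hence the counts for colors 1 and 4
    differ by more than 2.\<close>
  have "{(0, 0), (3, 0), (2, 1), (5, 1)} \<subseteq> colored_verts (circular_ladder 12) ladder_coloring 1"
    by (simp add: colored_verts_def verts_ladder ladder_coloring_def)
  then have "card {(0, 0), (3, 0), (2, 1), (5, 1) :: nat \<times> nat} \<le>
      card (colored_verts (circular_ladder 12) ladder_coloring 1)"
    by (rule card_mono[rotated]) (simp add: colored_verts_def verts_ladder)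
  then have "4 \<le> card (colored_verts (circular_ladder 12) ladder_coloring 1)"
    by simp
  moreover have "ladder_coloring (Inl v) \<noteq> 4" for v
    using mod_less_divisor[of 3 "fst v + snd v"]
    by (simp add: ladder_coloring_def split_beta del: mod_less_divisor)
  then have "colored_verts (circular_ladder 12) ladder_coloring 4 = {}"
    by (simp add: colored_verts_def)
  then have "card (colored_verts (circular_ladder 12) ladder_coloring 4) = 0"
    by simp
  ultimately have "\<not> card (colored_verts (circular_ladder 12) ladder_coloring 1)
      \<le> card (colored_verts (circular_ladder 12) ladder_coloring 4) + 2"
    by simp
  moreover have "1 \<in> {1..4::nat}" "4 \<in> {1..4::nat}"
    by simp_all
  ultimately show ?thesis
    unfolding equitable_iff by blast
qed

theorem corollary5p1:
  shows "\<not> (\<forall>(G :: nat graph) c.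
           cubic_graph G \<and> order G < 20 \<and> total_coloring 4 G c \<longrightarrow> equitable 4 G c)
       \<and> cubic_graph (circular_ladder 12) \<and> order (circular_ladder 12) = 12
       \<and> (\<exists>c. total_coloring 4 (circular_ladder 12) c \<and> \<not> equitable 4 (circular_ladder 12) c)
       \<and> (\<forall>(H :: 'a graph) c.
           cubic_graph H \<and> order H < 12 \<and> total_coloring 4 H c \<longrightarrow> equitable 4 H c)"
proof -
  have order: "order (circular_ladder 12) = 12"
    by (simp add: order_def verts_ladder)
  \<comment> \<open>The refuted assertion quantifies over graphs on \<open>nat\<close>, while the
    ladder lives on pairs; the injective pairing function carries the counterexample over.\<close>
  let ?G = "map_graph prod_encode (circular_ladder 12)"
  let ?c = "map_coloring prod_encode ladder_coloring"
  have "cubic_graph ?G \<and> order ?G < 20 \<and> total_coloring 4 ?G ?c \<and> \<not> equitable 4 ?G ?c"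
    using order cubic_ladder total_coloring_ladder not_equitable_ladder
    by (simp add: order_map_graph cubic_map_graph total_coloring_map_graph
        equitable_map_graph_iff inj_prod_encode)
  moreover have "equitable 4 H c"
    if "cubic_graph H" "order H < 12" "total_coloring 4 H c" for H :: "'a graph" and c
    using that cubic_coloring.equitable_if_small by (auto simp: cubic_coloring_def)
  ultimately show ?thesis
    using order cubic_ladder total_coloring_ladder not_equitable_ladder by blast
qed

end
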